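(* Let $\mathcal{V}$ be a combinatorial multivector field on a finite simplicial complex $K$ (with Alexandrov topology $\mathcal{T}$). Then: (i) The minimal Morse decomposition $\mathcal{M}(\mathcal{V})$ of $\mathcal{V}$ is a partition of $K$; in particular $\langle\mathcal{M}(\mathcal{V})\rangle=K$. (ii) If $\mathcal{W}$ is another combinatorial multivector field on $K$, then $\mathcal{V}\,\bar{\cap}\,\mathcal{W}$ is a combinatorial multivector field on $K$, and it is inscribed both in $\mathcal{V}$ and in $\mathcal{W}$. Moreover, if $\mathcal{V}\sqsubset\mathcal{W}$, then $F_{\mathcal{V}}\subseteq F_{\mathcal{W}}$, i.e. $F_{\mathcal{V}}(\sigma)\subseteq F_{\mathcal{W}}(\sigma)$ for all $\sigma\in K$. (iii) If $\mathcal{V}'$ is a combinatorial multivector field on a finite simplicial complex $K'$ and $f:K\to K'$ is continuous, then the pullback $f^*(\mathcal{V}'):=\{f^{-1}(V')\mid V'\in\mathcal{V}'\}$ is a combinatorial multivector field on $K$. (iv) With $\mathcal{V}'$, $K'$ and $f$ as in (iii), the map $$\kappa:(K,\mathcal{T}_{\mathcal{V}\bar{\cap}f^*(\mathcal{V}')})\to(K,\mathcal{T}_{\mathcal{V}})$$ given by the identity, $\kappa(\sigma)=\sigma$, and the map $$\lambda:(K,\mathcal{T}_{\mathcal{V}\bar{\cap}f^*(\mathcal{V}')})\to(K',\mathcal{T}'_{\mathcal{V}'})$$ given by $f$, $\lambda(\sigma)=f(\sigma)$, are continuous.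
   Context: A finite simplicial complex $K$ is regarded as the finite set of its simplices, partially ordered by the face relation ($\sigma\preceq\tau$ iff $\sigma$ is a face of $\tau$). Its Alexandrov topology $\mathcal{T}$ is the $T_0$ topology whose open sets are the upper sets for $\preceq$; thus $\operatorname{cl}\sigma$ is the set of all faces of $\sigma$. Continuity of $f:K\to K'$ is with respect to the Alexandrov topologies $\mathcal{T}$ on $K$ and $\mathcal{T}'$ on $K'$; equivalently, $f$ preserves the face relation. A subset $A\subseteq K$ is orderly convex if $\sigma_1,\sigma_2\in A$, $\tau\in K$, $\sigma_1\preceq\tau\preceq\sigma_2$ imply $\tau\in A$. A multivector is an orderly convex subset of $K$, and a combinatorial multivector field on $K$ is a partition $\mathcal{V}$ of $K$ into multivectors. $[\sigma]_{\mathcal{V}}$ denotes the unique $V\in\mathcal{V}$ containing $\sigma$. The associated combinatorial dynamical system is the multivalued map $F_{\mathcal{V}}:K\multimap K$, $F_{\mathcal{V}}(\sigma):=\operatorname{cl}\sigma\cup[\sigma]_{\mathcal{V}}$. For a multivalued map $F:K\multimap K$, $G_F$ is the digraph with vertex set $K$ and an edge from $\sigma$ to $\tau$ iff $\tau\in F(\sigma)$. The minimal Morse decomposition $\mathcal{M}(\mathcal{V})$ of $\mathcal{V}$ is the minimal Morse decomposition of $F_{\mathcal{V}}$, which is the family of all strongly connected components of $G_{F_{\mathcal{V}}}$ (maximal strongly connected vertex sets whose induced subgraph contains at least one edge). For families $\mathcal{A},\mathcal{B}$ of subsets of a set: $\langle\mathcal{A}\rangle:=\bigcup\mathcal{A}$;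 $\mathcal{A}\,\bar{\cap}\,\mathcal{B}$ is the family of intersections $A\cap B$ with $A\in\mathcal{A}$, $B\in\mathcal{B}$; $\mathcal{A}$ is inscribed in $\mathcal{B}$, written $\mathcal{A}\sqsubset\mathcal{B}$, if every $A\in\mathcal{A}$ is contained in some $B\in\mathcal{B}$. When $\mathcal{V}\,\bar{\cap}\,\mathcal{W}$ and $f^*(\mathcal{V}')$ are regarded as partitions, empty sets are discarded. For a finite family $\mathcal{A}$ of mutually disjoint non-empty subsets of a topological space $(X,\mathcal{T})$, $\mathcal{T}_{\mathcal{A}}$ is the topology on $\langle\mathcal{A}\rangle$ consisting of all unions of sets $A\cap U$ with $A\in\mathcal{A}$, $U\in\mathcal{T}$. For a combinatorial multivector field $\mathcal{V}$ on $K$, $\mathcal{T}_{\mathcal{V}}$ is shorthand for $\mathcal{T}_{\mathcal{M}(\mathcal{V})}$ (and similarly $\mathcal{T}'_{\mathcal{V}'}:=\mathcal{T}'_{\mathcal{M}(\mathcal{V}')}$ on $K'$). *)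

theory Defs
  imports
    "HOL-Library.Disjoint_Sets"
    "HOL-Analysis.Abstract_Topology"
    "Graph_Theory.Digraph_Component"
begin

text \<open>
  A simplicial complex is given by its set of simplices, each simplex being its finite, nonempty set
  of vertices, so that the face relation is inclusion. The predicate \<open>simplicial_complex\<close> of
  HOL-Analysis is not used because it makes the empty set a simplex of every nonempty complex.
\<close>

definition finite_simplicial_complex :: "'v set set \<Rightarrow> bool" where
  "finite_simplicial_complex K \<longleftrightarrow>
     finite K \<and>
     (\<forall>\<sigma>\<in>K. finite \<sigma> \<and> \<sigma> \<noteq> {}) \<and>
     (\<forall>\<tau>\<in>K. \<forall>\<sigma>. \<sigma> \<subseteq> \<tau> \<and> \<sigma> \<noteq> {} \<longrightarrow> \<sigma> \<in> K)"

definition alexandrov_topology :: "'v set set \<Rightarrow> 'v set topology" where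
  "alexandrov_topology K =
     topology (\<lambda>U. U \<subseteq> K \<and> (\<forall>\<sigma>\<in>U. \<forall>\<tau>\<in>K. \<sigma> \<subseteq> \<tau> \<longrightarrow> \<tau> \<in> U))"

lemma openin_alexandrov_topology:
  "openin (alexandrov_topology K) U \<longleftrightarrow> U \<subseteq> K \<and> (\<forall>\<sigma>\<in>U. \<forall>\<tau>\<in>K. \<sigma> \<subseteq> \<tau> \<longrightarrow> \<tau> \<in> U)"
proof -
  have "istopology (\<lambda>U. U \<subseteq> K \<and> (\<forall>\<sigma>\<in>U. \<forall>\<tau>\<in>K. \<sigma> \<subseteq> \<tau> \<longrightarrow> \<tau> \<in> U))" (is "istopology ?P")
    unfolding istopology_def
  proof (intro conjI allI impI)
    fix S T
    assume "?P S" and "?P T"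
    then show "S \<inter> T \<subseteq> K" and "\<forall>\<sigma>\<in>S \<inter> T. \<forall>\<tau>\<in>K. \<sigma> \<subseteq> \<tau> \<longrightarrow> \<tau> \<in> S \<inter> T"
      by auto
  next
    fix \<U>
    assume *: "\<forall>S\<in>\<U>. ?P S"
    then show "\<Union>\<U> \<subseteq> K"
      by auto
    show "\<forall>\<sigma>\<in>\<Union>\<U>. \<forall>\<tau>\<in>K. \<sigma> \<subseteq> \<tau> \<longrightarrow> \<tau> \<in> \<Union>\<U>"
    proof (intro ballI impI)
      fix \<sigma> \<tau>
      assume "\<sigma> \<in> \<Union>\<U>" "\<tau> \<in> K" "\<sigma> \<subseteq> \<tau>"
      then obtain S where "S \<in> \<U>" "\<sigma> \<in> S" by (elim UnionE)
      then show "\<tau> \<in> \<Union>\<U>"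
        using * \<open>\<tau> \<in> K\<close> \<open>\<sigma> \<subseteq> \<tau>\<close> by (intro UnionI[of S]) simp_all
    qed
  qed
  then show ?thesis
    by (simp add: alexandrov_topology_def topology_inverse')
qed

lemma topspace_alexandrov_topology: "topspace (alexandrov_topology K) = K"
  unfolding topspace_def openin_alexandrov_topology by blast

lemma closure_of_alexandrov_topology:
  assumes "\<sigma> \<in> K"
  shows "alexandrov_topology K closure_of {\<sigma>} = {\<tau>\<in>K. \<tau> \<subseteq> \<sigma>}"
proof (intro set_eqI iffI)
  fix \<tau>
  assume *: "\<tau> \<in> alexandrov_topology K closure_of {\<sigma>}"
  then have "\<tau> \<in> K"
    by (simp add: in_closure_of topspace_alexandrov_topology)
  have open_star: "openin (alexandrov_topology K) {\<rho>\<in>K. \<tau> \<subseteq> \<rho>}"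
    by (auto simp: openin_alexandrov_topology)
  have meets: "\<exists>y. y \<in> {\<sigma>} \<and> y \<in> T"
    if "\<tau> \<in> T" "openin (alexandrov_topology K) T" for T
    using * that unfolding in_closure_of by metis
  have "\<tau> \<subseteq> \<sigma>"
    using meets[OF _ open_star] \<open>\<tau> \<in> K\<close> by simp
  with \<open>\<tau> \<in> K\<close> show "\<tau> \<in> {\<tau>\<in>K. \<tau> \<subseteq> \<sigma>}"
    by simp
next
  fix \<tau>
  assume "\<tau> \<in> {\<tau>\<in>K. \<tau> \<subseteq> \<sigma>}"
  then show "\<tau> \<in> alexandrov_topology K closure_of {\<sigma>}"
    using assms
    by (simp add: in_closure_of topspace_alexandrov_topology openin_alexandrov_topology) blast
qed

definition orderly_convex :: "'v set set \<Rightarrow> 'v set set \<Rightarrow> bool" where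
  "orderly_convex K A \<longleftrightarrow>
     (\<forall>\<sigma>\<^sub>1\<in>A. \<forall>\<sigma>\<^sub>2\<in>A. \<forall>\<tau>\<in>K. \<sigma>\<^sub>1 \<subseteq> \<tau> \<and> \<tau> \<subseteq> \<sigma>\<^sub>2 \<longrightarrow> \<tau> \<in> A)"

definition multivector :: "'v set set \<Rightarrow> 'v set set \<Rightarrow> bool" where
  "multivector K A \<longleftrightarrow> A \<subseteq> K \<and> orderly_convex K A"

definition multivector_field :: "'v set set \<Rightarrow> 'v set set set \<Rightarrow> bool" where
  "multivector_field K \<V> \<longleftrightarrow> partition_on K \<V> \<and> (\<forall>V\<in>\<V>. multivector K V)"

definition class_of :: "'a set set \<Rightarrow> 'a \<Rightarrow> 'a set" where
  "class_of \<V> \<sigma> = (THE V. V \<in> \<V> \<and> \<sigma> \<in> V)"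

definition mvf_map :: "'v set set \<Rightarrow> 'v set set set \<Rightarrow> 'v set \<Rightarrow> 'v set set" where
  "mvf_map K \<V> \<sigma> = alexandrov_topology K closure_of {\<sigma>} \<union> class_of \<V> \<sigma>"

definition map_digraph :: "'a set \<Rightarrow> ('a \<Rightarrow> 'a set) \<Rightarrow> ('a, 'a \<times> 'a) pre_digraph" where
  "map_digraph X F =
     \<lparr> verts = X, arcs = {(x, y). x \<in> X \<and> y \<in> X \<and> y \<in> F x}, tail = fst, head = snd \<rparr>"

definition minimal_morse_decomposition :: "'a set \<Rightarrow> ('a \<Rightarrow> 'a set) \<Rightarrow> 'a set set" where
  "minimal_morse_decomposition X F =
     {verts H | H. H \<in> pre_digraph.sccs (map_digraph X F) \<and> arcs H \<noteq> {}}"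

definition morse_sets :: "'v set set \<Rightarrow> 'v set set set \<Rightarrow> 'v set set set" where
  "morse_sets K \<V> = minimal_morse_decomposition K (mvf_map K \<V>)"

definition family_meet :: "'a set set \<Rightarrow> 'a set set \<Rightarrow> 'a set set" where
  "family_meet \<A> \<B> = {A \<inter> B | A B. A \<in> \<A> \<and> B \<in> \<B>}"

definition inscribed :: "'a set set \<Rightarrow> 'a set set \<Rightarrow> bool" where
  "inscribed \<A> \<B> \<longleftrightarrow> (\<forall>A\<in>\<A>. \<exists>B\<in>\<B>. A \<subseteq> B)"

definition pullback :: "'a set \<Rightarrow> ('a \<Rightarrow> 'b) \<Rightarrow> 'b set set \<Rightarrow> 'a set set" where
  "pullback X f \<B> = {f -` B \<inter> X | B. B \<in> \<B>}"

definition discard_empty :: "'a set set \<Rightarrow> 'a set set" where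
  "discard_empty \<A> = \<A> - {{}}"

definition family_topology :: "'a topology \<Rightarrow> 'a set set \<Rightarrow> 'a topology" where
  "family_topology T \<A> =
     topology (arbitrary union_of (\<lambda>S. \<exists>A\<in>\<A>. \<exists>U. openin T U \<and> S = A \<inter> U))"

text \<open>Disjointness is what makes these unions closed under binary intersection.\<close>

lemma openin_family_topology:
  assumes "disjoint \<A>"
  shows "openin (family_topology T \<A>) S \<longleftrightarrow>
    (arbitrary union_of (\<lambda>S. \<exists>A\<in>\<A>. \<exists>U. openin T U \<and> S = A \<inter> U)) S"
proof -
  let ?P = "\<lambda>S. \<exists>A\<in>\<A>. \<exists>U. openin T U \<and> S = A \<inter> U"
  have "(arbitrary union_of ?P) (S \<inter> S')" if S: "?P S" and S': "?P S'" for S S'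
  proof -
    obtain A U B W where *: "A \<in> \<A>" "openin T U" "S = A \<inter> U" "B \<in> \<A>" "openin T W" "S' = B \<inter> W"
      using S S' by blast
    show ?thesis
    proof (cases "A = B")
      case True
      then have "S \<inter> S' = A \<inter> (U \<inter> W)" using * by blast
      then have "?P (S \<inter> S')" using * openin_Int by blast
      then show ?thesis by (rule arbitrary_union_of_inc)
    next
      case False
      then have "S \<inter> S' = {}" using * assms by (auto dest: disjointD)
      then show ?thesis by simp
    qed
  qed
  then have "(arbitrary union_of ?P) (S \<inter> S')"
    if "(arbitrary union_of ?P) S" "(arbitrary union_of ?P) S'" for S S'
    using arbitrary_union_of_Int_eq[of ?P] that by blast
  then have "istopology (arbitrary union_of ?P)"
    unfolding istopology_def using arbitrary_union_of_Union[of _ ?P] by simp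
  then show ?thesis
    by (simp add: family_topology_def topology_inverse')
qed

lemma topspace_family_topology:
  assumes "disjoint \<A>" and "\<Union>\<A> \<subseteq> topspace T"
  shows "topspace (family_topology T \<A>) = \<Union>\<A>"
proof
  show "topspace (family_topology T \<A>) \<subseteq> \<Union>\<A>"
    unfolding topspace_def openin_family_topology[OF assms(1)] arbitrary_union_of_alt by fast
  have "openin (family_topology T \<A>) A" if "A \<in> \<A>" for A
  proof -
    have "A = A \<inter> topspace T" using that assms(2) by blast
    then have "\<exists>B\<in>\<A>. \<exists>U. openin T U \<and> A = B \<inter> U"
      using that openin_topspace by metis
    then show ?thesis
      unfolding openin_family_topology[OF assms(1)] by (rule arbitrary_union_of_inc)
  qed
  then show "\<Union>\<A> \<subseteq> topspace (family_topology T \<A>)"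
    by (intro Sup_least openin_subset)
qed

definition morse_topology :: "'v set set \<Rightarrow> 'v set set set \<Rightarrow> 'v set topology" where
  "morse_topology K \<V> = family_topology (alexandrov_topology K) (morse_sets K \<V>)"

end

theory Submission
  imports Defs
begin

text \<open>
  Every \<open>\<sigma>\<close> lies in \<open>F\<^bsub>\<V>\<^esub>(\<sigma>)\<close>, being a face of itself, so each vertex of the digraph of \<open>F\<^bsub>\<V>\<^esub>\<close>
  carries a loop and no strongly connected component is lost for lack of an arc. The Morse sets are
  therefore exactly the classes of the equivalence relation of mutual reachability
  (\<open>minimal_morse_decomposition_eq_quotient\<close>), which gives the partition.

  Common refinements and pullbacks of partitions are partitions once the empty set is dropped.
  Order convexity survives intersections, and it survives preimages because a continuous map
  preserves the face relation. If \<open>\<V>\<close> is inscribed in \<open>\<W>\<close>, then the block of \<open>\<sigma>\<close> in \<open>\<V>\<close> is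
  contained in its block in \<open>\<W>\<close>, whence \<open>F\<^bsub>\<V>\<^esub>(\<sigma>) \<subseteq> F\<^bsub>\<W>\<^esub>(\<sigma>)\<close>.

  Both continuity claims are instances of one fact (\<open>continuous_map_morse_topology\<close>). A set is open
  in the Morse topology iff it is closed under passing from \<open>\<sigma>\<close> to a coface of \<open>\<sigma>\<close> in the same
  Morse set (\<open>openin_morse_topology\<close>), so a map is continuous for the Morse topologies as soon as it
  preserves faces and mutual reachability. If \<open>f\<close> is continuous and the field on its domain is
  inscribed in the pullback of the field on its codomain, then \<open>f\<close> takes arcs to arcs, hence walks
  to walks, hence mutually reachable simplices to mutually reachable ones. The common
  refinement of \<open>\<V>\<close> and \<open>f\<^sup>*(\<V>')\<close> is inscribed in \<open>f\<^sup>*(\<V>')\<close> and in \<open>\<V>\<close>, the latter being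
  the pullback of \<open>\<V>\<close> under the identity.
\<close>

section \<open>Reachability in the digraph of a multivalued map\<close>

lemma map_digraph_simps [simp]:
  "verts (map_digraph X F) = X"
  "x \<rightarrow>\<^bsub>map_digraph X F\<^esub> y \<longleftrightarrow> x \<in> X \<and> y \<in> X \<and> y \<in> F x"
  by (force simp: map_digraph_def arcs_ends_def arc_to_ends_def)+

lemma wf_digraph_map_digraph: "wf_digraph (map_digraph X F)"
  by unfold_locales (auto simp: map_digraph_def)

lemma reachable_map_digraph_in:
  assumes "x \<rightarrow>\<^sup>*\<^bsub>map_digraph X F\<^esub> y"
  shows "x \<in> X" "y \<in> X"
  using wf_digraph.reachable_in_verts[OF wf_digraph_map_digraph assms] by simp_all

definition mutually_reachable :: "'a set \<Rightarrow> ('a \<Rightarrow> 'a set) \<Rightarrow> ('a \<times> 'a) set" where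
  "mutually_reachable X F =
     {(x, y). x \<rightarrow>\<^sup>*\<^bsub>map_digraph X F\<^esub> y \<and> y \<rightarrow>\<^sup>*\<^bsub>map_digraph X F\<^esub> x}"

lemma equiv_mutually_reachable: "equiv X (mutually_reachable X F)"
proof -
  interpret wf_digraph "map_digraph X F"
    by (rule wf_digraph_map_digraph)
  show ?thesis
  proof (rule equivI)
    show "mutually_reachable X F \<subseteq> X \<times> X"
      unfolding mutually_reachable_def by (auto dest: reachable_map_digraph_in)
    show "refl_on X (mutually_reachable X F)"
      by (auto simp: refl_on_def mutually_reachable_def)
    show "sym (mutually_reachable X F)"
      by (auto simp: sym_def mutually_reachable_def)
    show "trans (mutually_reachable X F)"
      unfolding trans_def mutually_reachable_def using reachable_trans by blast
  qed
qed

text \<open>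
  Strongly connected components are the classes of mutual reachability. A component consisting of a
  single vertex may fail to contain an arc, and reflexivity of \<open>F\<close> rules this out.
\<close>

lemma minimal_morse_decomposition_eq_quotient:
  assumes refl: "\<And>x. x \<in> X \<Longrightarrow> x \<in> F x"
  shows "minimal_morse_decomposition X F = X // mutually_reachable X F"
proof -
  let ?G = "map_digraph X F" and ?R = "mutually_reachable X F"
  interpret wf_digraph ?G
    by (rule wf_digraph_map_digraph)
  have eq: "equiv X ?R"
    by (rule equiv_mutually_reachable)
  have "arcs H \<noteq> {}" if H: "H \<in> sccs" for H
  proof -
    from H have ind: "induced_subgraph H ?G" and "verts H \<noteq> {}"
      by (auto simp: sccs_def strongly_connected_def)
    then obtain x where x: "x \<in> verts H"
      by blast
    moreover have "x \<in> X"
      using x ind subgraph_imp_subverts induced_imp_subgraph by fastforce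
    ultimately have "(x, x) \<in> arcs H"
      using ind refl by (auto simp: induced_subgraph_def map_digraph_def)
    then show ?thesis
      by blast
  qed
  then have "minimal_morse_decomposition X F = sccs_verts"
    by (auto simp: minimal_morse_decomposition_def sccs_verts_conv)
  also have "\<dots> = X // ?R"
  proof (intro set_eqI iffI)
    fix S
    assume S: "S \<in> sccs_verts"
    then obtain x where x: "x \<in> S"
      by (auto simp: sccs_verts_def)
    with S have "x \<rightarrow>\<^sup>*\<^bsub>?G\<^esub> x"
      by (auto simp: sccs_verts_def)
    then have "x \<in> X"
      by (rule reachable_map_digraph_in)
    moreover have "S = ?R `` {x}"
      using S x by (auto simp: sccs_verts_def mutually_reachable_def)
    ultimately show "S \<in> X // ?R"
      by (auto intro: quotientI)
  next
    fix S
    assume "S \<in> X // ?R"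
    then obtain x where x: "x \<in> X" and S: "S = ?R `` {x}"
      by (auto elim: quotientE)
    show "S \<in> sccs_verts"
      unfolding sccs_verts_def
    proof (intro CollectI conjI ballI allI impI)
      show "S \<noteq> {}"
        using equiv_class_self[OF eq x] S by blast
      show "u \<rightarrow>\<^sup>*\<^bsub>?G\<^esub> v" if "u \<in> S" "v \<in> S" for u v
        using that reachable_trans unfolding S mutually_reachable_def by blast
      show "\<not> u \<rightarrow>\<^sup>*\<^bsub>?G\<^esub> v \<or> \<not> v \<rightarrow>\<^sup>*\<^bsub>?G\<^esub> u" if "u \<in> S" "v \<notin> S" for u v
        using that reachable_trans unfolding S mutually_reachable_def by blast
    qed
  qed
  finally show ?thesis .
qed

lemma mutually_reachable_map:
  assumes g: "g \<in> X \<rightarrow> Y"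
    and arc: "\<And>x y. x \<in> X \<Longrightarrow> y \<in> X \<Longrightarrow> y \<in> F x \<Longrightarrow> g y \<in> G (g x)"
    and xy: "(x, y) \<in> mutually_reachable X F"
  shows "(g x, g y) \<in> mutually_reachable Y G"
proof -
  interpret X: wf_digraph "map_digraph X F"
    by (rule wf_digraph_map_digraph)
  interpret Y: wf_digraph "map_digraph Y G"
    by (rule wf_digraph_map_digraph)
  have "g a \<rightarrow>\<^sup>*\<^bsub>map_digraph Y G\<^esub> g b" if "a \<rightarrow>\<^sup>*\<^bsub>map_digraph X F\<^esub> b" for a b
    using that
  proof (induction rule: X.reachable_induct)
    case base
    then show ?case
      using g by auto
  next
    case (step b c)
    then have "g b \<rightarrow>\<^bsub>map_digraph Y G\<^esub> g c"
      using g arc by auto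
    with step.IH show ?case
      by (rule Y.reachable_adj_trans)
  qed
  with xy show ?thesis
    by (auto simp: mutually_reachable_def)
qed

section \<open>Multivector fields and their dynamics\<close>

lemma class_of_partition:
  assumes "partition_on K \<V>" "V \<in> \<V>" "\<sigma> \<in> V"
  shows "class_of \<V> \<sigma> = V"
proof -
  have "W = V" if "W \<in> \<V>" "\<sigma> \<in> W" for W
    using that assms disjointD[OF partition_onD2[OF assms(1)], of W V] by blast
  then show ?thesis
    unfolding class_of_def using assms by (metis (no_types, lifting) the_equality)
qed

lemma mvf_map_iff:
  assumes "partition_on K \<V>" "\<sigma> \<in> K"
  shows "\<tau> \<in> mvf_map K \<V> \<sigma> \<longleftrightarrow> \<tau> \<in> K \<and> (\<tau> \<subseteq> \<sigma> \<or> (\<exists>V\<in>\<V>. \<sigma> \<in> V \<and> \<tau> \<in> V))"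
proof -
  obtain V where V: "V \<in> \<V>" "\<sigma> \<in> V"
    using assms by (auto simp: partition_on_def)
  have "V \<subseteq> K"
    using V assms(1) by (auto simp: partition_on_def)
  moreover have "(\<exists>W\<in>\<V>. \<sigma> \<in> W \<and> \<tau> \<in> W) \<longleftrightarrow> \<tau> \<in> V"
    using V class_of_partition[OF assms(1)] by metis
  ultimately show ?thesis
    unfolding mvf_map_def closure_of_alexandrov_topology[OF assms(2)]
      class_of_partition[OF assms(1) V] by blast
qed

lemma mvf_map_mono_inscribed:
  assumes "partition_on K \<V>" "partition_on K \<W>" "inscribed \<V> \<W>" "\<sigma> \<in> K"
  shows "mvf_map K \<V> \<sigma> \<subseteq> mvf_map K \<W> \<sigma>"
proof
  fix \<tau>
  assume "\<tau> \<in> mvf_map K \<V> \<sigma>"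
  then show "\<tau> \<in> mvf_map K \<W> \<sigma>"
    using assms(3)
    unfolding mvf_map_iff[OF assms(1,4)] mvf_map_iff[OF assms(2,4)] inscribed_def
    by (meson subsetD)
qed

lemma multivector_Int:
  assumes "multivector K V" "multivector K W"
  shows "multivector K (V \<inter> W)"
  unfolding multivector_def orderly_convex_def
proof (intro conjI ballI impI)
  show "V \<inter> W \<subseteq> K"
    using assms(1) by (auto simp: multivector_def)
  fix \<rho> \<sigma> \<tau>
  assume *: "\<rho> \<in> V \<inter> W" "\<sigma> \<in> V \<inter> W" "\<tau> \<in> K" "\<rho> \<subseteq> \<tau> \<and> \<tau> \<subseteq> \<sigma>"
  have "\<tau> \<in> V"
    using assms(1) * unfolding multivector_def orderly_convex_def by (metis IntD1)
  moreover have "\<tau> \<in> W"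
    using assms(2) * unfolding multivector_def orderly_convex_def by (metis IntD2)
  ultimately show "\<tau> \<in> V \<inter> W"
    by simp
qed

lemma multivector_field_family_meet:
  assumes "multivector_field K \<V>" "multivector_field K \<W>"
  shows "multivector_field K (discard_empty (family_meet \<V> \<W>))"
  unfolding multivector_field_def
proof (intro conjI ballI)
  have V: "\<Union>\<V> = K" "disjoint \<V>" and W: "\<Union>\<W> = K" "disjoint \<W>"
    using assms by (auto simp: multivector_field_def partition_on_def)
  show "partition_on K (discard_empty (family_meet \<V> \<W>))"
  proof (rule partition_onI)
    show "\<Union>(discard_empty (family_meet \<V> \<W>)) = K"
      using V(1) W(1) unfolding discard_empty_def family_meet_def by blast
    show "disjnt p q" if pq: "p \<in> discard_empty (family_meet \<V> \<W>)"
      "q \<in> discard_empty (family_meet \<V> \<W>)" "p \<noteq> q" for p q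
    proof -
      obtain A B where p: "p = A \<inter> B" "A \<in> \<V>" "B \<in> \<W>"
        using pq(1) by (auto simp: discard_empty_def family_meet_def)
      obtain C D where q: "q = C \<inter> D" "C \<in> \<V>" "D \<in> \<W>"
        using pq(2) by (auto simp: discard_empty_def family_meet_def)
      have "A \<inter> C = {} \<or> B \<inter> D = {}"
        using p q \<open>p \<noteq> q\<close> disjointD[OF V(2)] disjointD[OF W(2)] by metis
      then show ?thesis
        unfolding disjnt_def p(1) q(1) by blast
    qed
  qed (simp add: discard_empty_def)
next
  fix A
  assume "A \<in> discard_empty (family_meet \<V> \<W>)"
  then obtain V W where "V \<in> \<V>" "W \<in> \<W>" and A: "A = V \<inter> W"
    by (auto simp: discard_empty_def family_meet_def)
  then have "multivector K V" "multivector K W"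
    using assms by (auto simp: multivector_field_def)
  then show "multivector K A"
    unfolding A by (rule multivector_Int)
qed

lemma inscribed_family_meet:
  "inscribed (discard_empty (family_meet \<A> \<B>)) \<A>"
  "inscribed (discard_empty (family_meet \<A> \<B>)) \<B>"
  by (auto simp: inscribed_def discard_empty_def family_meet_def)

text \<open>
  The set of cofaces of \<open>f \<sigma>\<close> is open and contains \<open>f \<sigma>\<close>, so its preimage contains all cofaces
  of \<open>\<sigma>\<close>.
\<close>

lemma continuous_map_alexandrov_mono:
  assumes f: "continuous_map (alexandrov_topology K) (alexandrov_topology K') f"
    and "\<sigma> \<in> K" "\<tau> \<in> K" "\<sigma> \<subseteq> \<tau>"
  shows "f \<sigma> \<subseteq> f \<tau>"
proof -
  let ?star = "{\<rho>\<in>K'. f \<sigma> \<subseteq> \<rho>}"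
  have "openin (alexandrov_topology K') ?star"
    by (auto simp: openin_alexandrov_topology)
  then have "openin (alexandrov_topology K) {\<rho>\<in>K. f \<rho> \<in> ?star}"
    using openin_continuous_map_preimage[OF f] unfolding topspace_alexandrov_topology by blast
  moreover have "f \<sigma> \<in> K'"
    using continuous_map_funspace[OF f] \<open>\<sigma> \<in> K\<close> by (auto simp: topspace_alexandrov_topology)
  ultimately show ?thesis
    using assms(2-4) unfolding openin_alexandrov_topology by blast
qed

lemma multivector_field_pullback:
  assumes "multivector_field K' \<V>'"
    and f: "continuous_map (alexandrov_topology K) (alexandrov_topology K') f"
  shows "multivector_field K (discard_empty (pullback K f \<V>'))"
  unfolding multivector_field_def
proof (intro conjI ballI)
  have V': "\<Union>\<V>' = K'" "disjoint \<V>'"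
    using assms by (auto simp: multivector_field_def partition_on_def)
  have fK: "f \<in> K \<rightarrow> K'"
    using continuous_map_funspace[OF f] by (simp add: topspace_alexandrov_topology)
  show "partition_on K (discard_empty (pullback K f \<V>'))"
  proof (rule partition_onI)
    show "\<Union>(discard_empty (pullback K f \<V>')) = K"
      using V'(1) fK unfolding discard_empty_def pullback_def by blast
    show "disjnt p q" if pq: "p \<in> discard_empty (pullback K f \<V>')"
      "q \<in> discard_empty (pullback K f \<V>')" "p \<noteq> q" for p q
    proof -
      obtain A where p: "p = f -` A \<inter> K" "A \<in> \<V>'"
        using pq(1) by (auto simp: discard_empty_def pullback_def)
      obtain B where q: "q = f -` B \<inter> K" "B \<in> \<V>'"
        using pq(2) by (auto simp: discard_empty_def pullback_def)
      have "A \<inter> B = {}"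
        using p q \<open>p \<noteq> q\<close> disjointD[OF V'(2)] by metis
      then show ?thesis
        unfolding disjnt_def p(1) q(1) by blast
    qed
  qed (simp add: discard_empty_def)
  fix A
  assume "A \<in> discard_empty (pullback K f \<V>')"
  then obtain V where "V \<in> \<V>'" and A: "A = f -` V \<inter> K"
    by (auto simp: discard_empty_def pullback_def)
  then have V: "orderly_convex K' V"
    using assms by (auto simp: multivector_field_def multivector_def)
  have "\<tau> \<in> A" if "\<rho> \<in> A" "\<sigma> \<in> A" "\<tau> \<in> K" "\<rho> \<subseteq> \<tau>" "\<tau> \<subseteq> \<sigma>" for \<rho> \<sigma> \<tau>
  proof -
    have "f \<rho> \<subseteq> f \<tau>" "f \<tau> \<subseteq> f \<sigma>"
      using that continuous_map_alexandrov_mono[OF f] by (auto simp: A)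
    moreover have "f \<tau> \<in> K'" "f \<rho> \<in> V" "f \<sigma> \<in> V"
      using that fK by (auto simp: A)
    ultimately show ?thesis
      using V \<open>\<tau> \<in> K\<close> unfolding orderly_convex_def A by blast
  qed
  moreover have "A \<subseteq> K"
    by (simp add: A)
  ultimately show "multivector K A"
    unfolding multivector_def orderly_convex_def by blast
qed

section \<open>Morse sets and the Morse topology\<close>

lemma morse_sets_eq_quotient:
  assumes "partition_on K \<V>"
  shows "morse_sets K \<V> = K // mutually_reachable K (mvf_map K \<V>)"
  unfolding morse_sets_def
  by (rule minimal_morse_decomposition_eq_quotient) (simp add: mvf_map_iff[OF assms])

lemma partition_on_morse_sets:
  assumes "partition_on K \<V>"
  shows "partition_on K (morse_sets K \<V>)"
  unfolding morse_sets_eq_quotient[OF assms]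
  by (rule partition_on_quotient[OF equiv_mutually_reachable])

lemma openin_morse_topology:
  assumes "partition_on K \<V>"
  shows "openin (morse_topology K \<V>) U \<longleftrightarrow>
    U \<subseteq> K \<and> (\<forall>\<sigma>\<in>U. \<forall>\<tau>\<in>K. \<sigma> \<subseteq> \<tau> \<and> (\<sigma>, \<tau>) \<in> mutually_reachable K (mvf_map K \<V>) \<longrightarrow> \<tau> \<in> U)"
    (is "_ \<longleftrightarrow> ?closed U")
proof -
  let ?R = "mutually_reachable K (mvf_map K \<V>)"
  let ?basic = "\<lambda>S. \<exists>A\<in>K // ?R. \<exists>W. openin (alexandrov_topology K) W \<and> S = A \<inter> W"
  have eq: "equiv K ?R"
    by (rule equiv_mutually_reachable)
  have "disjoint (K // ?R)"
    using partition_on_quotient[OF eq] by (rule partition_onD2)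
  then have "openin (morse_topology K \<V>) U \<longleftrightarrow> (arbitrary union_of ?basic) U"
    by (simp add: morse_topology_def morse_sets_eq_quotient[OF assms] openin_family_topology)
  also have "\<dots> \<longleftrightarrow> ?closed U"
  proof
    assume U: "(arbitrary union_of ?basic) U"
    show "?closed U"
    proof (intro conjI ballI impI)
      show "U \<subseteq> K"
        using U openin_subset[of "alexandrov_topology K"]
        unfolding arbitrary_union_of_alt topspace_alexandrov_topology by blast
      fix \<sigma> \<tau>
      assume *: "\<sigma> \<in> U" "\<tau> \<in> K" "\<sigma> \<subseteq> \<tau> \<and> (\<sigma>, \<tau>) \<in> ?R"
      then obtain A W where A: "A \<in> K // ?R" and W: "openin (alexandrov_topology K) W"
        and "\<sigma> \<in> A \<inter> W" "A \<inter> W \<subseteq> U"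
        using U unfolding arbitrary_union_of_alt by blast
      moreover have "\<tau> \<in> A"
        using * A \<open>\<sigma> \<in> A \<inter> W\<close> in_quotient_imp_closed[OF eq] by blast
      moreover have "\<tau> \<in> W"
        using * W \<open>\<sigma> \<in> A \<inter> W\<close> by (auto simp: openin_alexandrov_topology)
      ultimately show "\<tau> \<in> U"
        by blast
    qed
  next
    assume U: "?closed U"
    \<comment> \<open>the neighbourhood of \<open>\<sigma>\<close> inside \<open>U\<close>: all cofaces of \<open>\<sigma>\<close> in its own Morse set\<close>
    have "\<exists>S. ?basic S \<and> \<sigma> \<in> S \<and> S \<subseteq> U" if "\<sigma> \<in> U" for \<sigma>
    proof (intro exI conjI)
      have \<sigma>: "\<sigma> \<in> K"
        using that U by blast
      have "openin (alexandrov_topology K) {\<tau>\<in>K. \<sigma> \<subseteq> \<tau>}"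
        by (auto simp: openin_alexandrov_topology)
      then show "?basic (?R `` {\<sigma>} \<inter> {\<tau>\<in>K. \<sigma> \<subseteq> \<tau>})"
        using quotientI[OF \<sigma>] by blast
      show "\<sigma> \<in> ?R `` {\<sigma>} \<inter> {\<tau>\<in>K. \<sigma> \<subseteq> \<tau>}"
        using equiv_class_self[OF eq \<sigma>] \<sigma> by blast
      show "?R `` {\<sigma>} \<inter> {\<tau>\<in>K. \<sigma> \<subseteq> \<tau>} \<subseteq> U"
        using U that by blast
    qed
    then show "(arbitrary union_of ?basic) U"
      unfolding arbitrary_union_of_alt by blast
  qed
  finally show ?thesis .
qed

lemma topspace_morse_topology:
  assumes "partition_on K \<V>"
  shows "topspace (morse_topology K \<V>) = K"
  using partition_on_morse_sets[OF assms]
  by (simp add: morse_topology_def partition_on_def topspace_family_topology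
      topspace_alexandrov_topology)

text \<open>
  An arc \<open>\<sigma> \<rightarrow> \<tau>\<close> arises either from a face \<open>\<tau>\<close> of \<open>\<sigma>\<close>, and continuity sends it to a face, or from a
  common block of \<open>\<V>\<close>, and inscription in the pullback sends it into a common block of \<open>\<V>'\<close>. Thus
  arcs go to arcs and Morse sets go into Morse sets.
\<close>

lemma continuous_map_morse_topology:
  assumes \<V>: "partition_on K \<V>" and \<V>': "partition_on K' \<V>'"
    and f: "continuous_map (alexandrov_topology K) (alexandrov_topology K') f"
    and ins: "inscribed \<V> (pullback K f \<V>')"
  shows "continuous_map (morse_topology K \<V>) (morse_topology K' \<V>') f"
proof -
  let ?R = "mutually_reachable K (mvf_map K \<V>)"
    and ?R' = "mutually_reachable K' (mvf_map K' \<V>')"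
  note mono = continuous_map_alexandrov_mono[OF f]
  have fK: "f \<in> K \<rightarrow> K'"
    using continuous_map_funspace[OF f] by (simp add: topspace_alexandrov_topology)
  have arc: "f \<tau> \<in> mvf_map K' \<V>' (f \<sigma>)"
    if \<sigma>: "\<sigma> \<in> K" and \<tau>: "\<tau> \<in> K" "\<tau> \<in> mvf_map K \<V> \<sigma>" for \<sigma> \<tau>
  proof -
    have "f \<sigma> \<in> K'" "f \<tau> \<in> K'"
      using fK \<sigma> \<tau> by auto
    moreover have "f \<tau> \<subseteq> f \<sigma> \<or> (\<exists>V'\<in>\<V>'. f \<sigma> \<in> V' \<and> f \<tau> \<in> V')"
    proof (cases "\<tau> \<subseteq> \<sigma>")
      case True
      then show ?thesis
        using mono[OF \<tau>(1) \<sigma>] by simp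
    next
      case False
      then obtain V where "V \<in> \<V>" "\<sigma> \<in> V" "\<tau> \<in> V"
        using \<tau>(2) mvf_map_iff[OF \<V> \<sigma>] by auto
      then show ?thesis
        using ins by (fastforce simp: inscribed_def pullback_def)
    qed
    ultimately show ?thesis
      by (simp add: mvf_map_iff[OF \<V>'])
  qed
  have reach: "(f \<sigma>, f \<tau>) \<in> ?R'" if "(\<sigma>, \<tau>) \<in> ?R" for \<sigma> \<tau>
    using fK arc that by (rule mutually_reachable_map)
  show ?thesis
    unfolding continuous_map_def topspace_morse_topology[OF \<V>] topspace_morse_topology[OF \<V>']
      openin_morse_topology[OF \<V>] openin_morse_topology[OF \<V>']
  proof (intro conjI allI impI)
    fix U
    assume U: "U \<subseteq> K' \<and> (\<forall>\<sigma>\<in>U. \<forall>\<tau>\<in>K'. \<sigma> \<subseteq> \<tau> \<and> (\<sigma>, \<tau>) \<in> ?R' \<longrightarrow> \<tau> \<in> U)"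
    show "\<forall>\<sigma>\<in>{x \<in> K. f x \<in> U}. \<forall>\<tau>\<in>K. \<sigma> \<subseteq> \<tau> \<and> (\<sigma>, \<tau>) \<in> ?R \<longrightarrow> \<tau> \<in> {x \<in> K. f x \<in> U}"
    proof (intro ballI impI)
      fix \<sigma> \<tau>
      assume "\<sigma> \<in> {x \<in> K. f x \<in> U}" "\<tau> \<in> K" "\<sigma> \<subseteq> \<tau> \<and> (\<sigma>, \<tau>) \<in> ?R"
      then have "f \<sigma> \<subseteq> f \<tau>" "(f \<sigma>, f \<tau>) \<in> ?R'" "f \<sigma> \<in> U" "f \<tau> \<in> K'"
        using mono reach fK by auto
      then show "\<tau> \<in> {x \<in> K. f x \<in> U}"
        using U \<open>\<tau> \<in> K\<close> by blast
    qed
  qed (use fK in auto)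
qed

section \<open>Morse decompositions, refinements and pullbacks\<close>

theorem theorem5p4:
  fixes K :: "'v set set" and \<V> :: "'v set set set"
  assumes "finite_simplicial_complex K"
    and "multivector_field K \<V>"
  shows
    "(partition_on K (morse_sets K \<V>) \<and> \<Union>(morse_sets K \<V>) = K) \<and>
     (\<forall>\<W>. multivector_field K \<W> \<longrightarrow>
        multivector_field K (discard_empty (family_meet \<V> \<W>)) \<and>
        inscribed (discard_empty (family_meet \<V> \<W>)) \<V> \<and>
        inscribed (discard_empty (family_meet \<V> \<W>)) \<W> \<and>
        (inscribed \<V> \<W> \<longrightarrow> (\<forall>\<sigma>\<in>K. mvf_map K \<V> \<sigma> \<subseteq> mvf_map K \<W> \<sigma>))) \<and>
     (\<forall>(K' :: 'w set set) \<V>' f.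
        finite_simplicial_complex K' \<and> multivector_field K' \<V>' \<and>
        continuous_map (alexandrov_topology K) (alexandrov_topology K') f \<longrightarrow>
          multivector_field K (discard_empty (pullback K f \<V>')) \<and>
          continuous_map
            (morse_topology K (discard_empty (family_meet \<V> (pullback K f \<V>'))))
            (morse_topology K \<V>) (\<lambda>\<sigma>. \<sigma>) \<and>
          continuous_map
            (morse_topology K (discard_empty (family_meet \<V> (pullback K f \<V>'))))
            (morse_topology K' \<V>') f)"
proof (intro conjI allI impI)
  have \<V>: "partition_on K \<V>"
    using assms(2) by (simp add: multivector_field_def)
  show "partition_on K (morse_sets K \<V>)"
    using \<V> by (rule partition_on_morse_sets)
  then show "\<Union>(morse_sets K \<V>) = K"
    by (rule partition_onD1[symmetric])
  show "multivector_field K (discard_empty (family_meet \<V> \<W>))" if "multivector_field K \<W>" for \<W>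
    using assms(2) that by (rule multivector_field_family_meet)
  show "inscribed (discard_empty (family_meet \<V> \<W>)) \<V>" for \<W>
    by (rule inscribed_family_meet)
  show "inscribed (discard_empty (family_meet \<V> \<W>)) \<W>" for \<W>
    by (rule inscribed_family_meet)
  show "\<forall>\<sigma>\<in>K. mvf_map K \<V> \<sigma> \<subseteq> mvf_map K \<W> \<sigma>"
    if "multivector_field K \<W>" "inscribed \<V> \<W>" for \<W>
    using that mvf_map_mono_inscribed[OF \<V>] by (auto simp: multivector_field_def)
next
  fix K' :: "'w set set" and \<V>' f
  assume *: "finite_simplicial_complex K' \<and> multivector_field K' \<V>' \<and>
    continuous_map (alexandrov_topology K) (alexandrov_topology K') f"
  let ?P = "pullback K f \<V>'"
  let ?\<W> = "discard_empty (family_meet \<V> ?P)"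
  from * show pull: "multivector_field K (discard_empty ?P)"
    by (blast intro: multivector_field_pullback)
  have "?\<W> = discard_empty (family_meet \<V> (discard_empty ?P))"
    unfolding discard_empty_def family_meet_def by blast
  then have \<W>: "partition_on K ?\<W>"
    using multivector_field_family_meet[OF assms(2) pull] by (simp add: multivector_field_def)
  have \<V>: "partition_on K \<V>" and \<V>': "partition_on K' \<V>'"
    using assms(2) * by (simp_all add: multivector_field_def)
  have "(\<lambda>\<sigma>. \<sigma>) -` B \<inter> K = B" if "B \<in> \<V>" for B
    using that \<V> by (auto simp: partition_on_def)
  then have "pullback K (\<lambda>\<sigma>. \<sigma>) \<V> = \<V>"
    by (simp add: pullback_def Setcompr_eq_image cong: image_cong_simp)
  then have "inscribed ?\<W> (pullback K (\<lambda>\<sigma>. \<sigma>) \<V>)"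
    by (simp add: inscribed_family_meet)
  then show "continuous_map (morse_topology K ?\<W>) (morse_topology K \<V>) (\<lambda>\<sigma>. \<sigma>)"
    by (intro continuous_map_morse_topology \<W> \<V>) simp_all
  show "continuous_map (morse_topology K ?\<W>) (morse_topology K' \<V>') f"
    using * by (intro continuous_map_morse_topology \<W> \<V>' inscribed_family_meet) simp
qed

end
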